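(* Let $q\ge2$ be an integer and let $X,Y\in\mathcal S^q$ be coprime, taken with disjoint supports so that $X*Y=X\times Y$. Then (1) $S_{X*Y}=S_X*S_Y$; (2) $M_{X*Y}=M_X*M_Y$.
   Context: Let $\mathrm{Sym}_f(\mathbb N)$ be the group of finitary permutations of $\mathbb N$; for $X\subset \mathrm{Sym}_f(\mathbb N)$ let $\mathrm{supp}(X)=\bigcup_{\rho\in X}\mathrm{supp}(\rho)$. $\mathcal S^q$ is the collection of nonempty finite subsets $X\ne\{1\}$ of $\mathrm{Sym}_f(\mathbb N)$ such that each $\rho\in X$ is a product of disjoint $q$-cycles and $\mathrm{supp}(\rho)=\mathrm{supp}(X)$ for every $\rho\in X$. For $X,Y$ with disjoint supports, $X*Y=X\times Y=\{xy:x\in X,y\in Y\}$, and the same notation is used for subgroups with disjoint supports. For $X\in\mathcal S^q$: $G_X=\mathrm{Sym}(\mathrm{supp}\,X)$; $N_X=\{g\in G_X: g^{-1}Xg=X\}$; $S_X$ is the centralizer of $X$ in $G_X$; $M_X=N_X/S_X$. $X$ and $Y$ (with disjoint supports) are coprime if $N_{X*Y}=N_X*N_Y$, equivalently $N_{X*Y}\le G_X*G_Y$. $M_X*M_Y$ denotes the subgroup $(N_X*N_Y)S_{X*Y}/S_{X*Y}$ of $M_{X*Y}$, which is naturally identified with $M_X\times M_Y$ because $S_{X*Y}\cap(N_X*N_Y)=S_X*S_Y$. *)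

theory Defs
  imports "HOL-Algebra.Coset" "HOL-Combinatorics.Cycles"
begin

definition supp_perm :: "(nat \<Rightarrow> nat) \<Rightarrow> nat set"
  where "supp_perm \<rho> = {n. \<rho> n \<noteq> n}"

definition supp :: "(nat \<Rightarrow> nat) set \<Rightarrow> nat set"
  where "supp X = (\<Union>\<rho>\<in>X. supp_perm \<rho>)"

definition Symf :: "(nat \<Rightarrow> nat) monoid"
  where "Symf = \<lparr>carrier = {\<rho>. bij \<rho> \<and> finite (supp_perm \<rho>)}, monoid.mult = (\<circ>), one = id\<rparr>"

lemma group_Symf: "group Symf"
proof (rule groupI)
  fix x y assume "x \<in> carrier Symf" "y \<in> carrier Symf"
  then have b: "bij x" "bij y" and f: "finite (supp_perm x \<union> supp_perm y)"
    by (auto simp: Symf_def)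
  have "supp_perm (x \<circ> y) \<subseteq> supp_perm x \<union> supp_perm y"
    by (auto simp: supp_perm_def)
  then have "finite (supp_perm (x \<circ> y))"
    using f finite_subset by blast
  then show "x \<otimes>\<^bsub>Symf\<^esub> y \<in> carrier Symf"
    using b by (simp add: Symf_def bij_comp)
next
  fix x assume "x \<in> carrier Symf"
  then have b: "bij x" and f: "finite (supp_perm x)"
    by (auto simp: Symf_def)
  have "supp_perm (inv_into UNIV x) = supp_perm x"
    unfolding supp_perm_def using bij_inv_eq_iff[OF b] by metis
  then have "inv_into UNIV x \<in> carrier Symf" "inv_into UNIV x \<otimes>\<^bsub>Symf\<^esub> x = \<one>\<^bsub>Symf\<^esub>"
    using b f by (auto simp: Symf_def bij_imp_bij_inv bij_is_inj)
  then show "\<exists>y\<in>carrier Symf. y \<otimes>\<^bsub>Symf\<^esub> x = \<one>\<^bsub>Symf\<^esub>" by blast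
qed (auto simp: Symf_def supp_perm_def comp_assoc)

text \<open>Distinctness of \<open>concat css\<close> says both that each list in \<open>css\<close> has distinct entries,
  hence describes a cycle, and that these cycles are pairwise disjoint.\<close>

definition prod_of_disjoint_cycles :: "nat \<Rightarrow> (nat \<Rightarrow> nat) \<Rightarrow> bool"
  where "prod_of_disjoint_cycles q \<rho> \<longleftrightarrow>
    (\<exists>css. distinct (concat css) \<and> (\<forall>cs\<in>set css. length cs = q) \<and>
           \<rho> = foldr (\<circ>) (map cycle_of_list css) id)"

definition Sq :: "nat \<Rightarrow> (nat \<Rightarrow> nat) set set"
  where "Sq q = {X. X \<subseteq> carrier Symf \<and> finite X \<and> X \<noteq> {} \<and> X \<noteq> {\<one>\<^bsub>Symf\<^esub>} \<and>
    (\<forall>\<rho>\<in>X. prod_of_disjoint_cycles q \<rho> \<and> supp_perm \<rho> = supp X)}"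

text \<open>The elementwise product, used for subsets and for subgroups; the disjointness of the
  supports is a separate hypothesis wherever it is used.\<close>

abbreviation star :: "(nat \<Rightarrow> nat) set \<Rightarrow> (nat \<Rightarrow> nat) set \<Rightarrow> (nat \<Rightarrow> nat) set"
    (infixl \<open>\<star>\<close> 70)
  where "X \<star> Y \<equiv> X <#>\<^bsub>Symf\<^esub> Y"

text \<open>\<open>Sym (supp X)\<close>, as the subgroup of permutations fixing every point outside \<open>supp X\<close>.\<close>

definition G_of :: "(nat \<Rightarrow> nat) set \<Rightarrow> (nat \<Rightarrow> nat) set"
  where "G_of X = {g \<in> carrier Symf. supp_perm g \<subseteq> supp X}"

definition N_of :: "(nat \<Rightarrow> nat) set \<Rightarrow> (nat \<Rightarrow> nat) set"
  where "N_of X = {g \<in> G_of X. inv\<^bsub>Symf\<^esub> g <#\<^bsub>Symf\<^esub> (X #>\<^bsub>Symf\<^esub> g) = X}"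

definition S_of :: "(nat \<Rightarrow> nat) set \<Rightarrow> (nat \<Rightarrow> nat) set"
  where "S_of X = {g \<in> G_of X. \<forall>x\<in>X. g \<otimes>\<^bsub>Symf\<^esub> x = x \<otimes>\<^bsub>Symf\<^esub> g}"

definition M_of :: "(nat \<Rightarrow> nat) set \<Rightarrow> (nat \<Rightarrow> nat) set monoid"
  where "M_of X = Symf\<lparr>carrier := N_of X\<rparr> Mod S_of X"

definition coprime_sets :: "(nat \<Rightarrow> nat) set \<Rightarrow> (nat \<Rightarrow> nat) set \<Rightarrow> bool"
  where "coprime_sets X Y \<longleftrightarrow> N_of (X \<star> Y) = N_of X \<star> N_of Y"

text \<open>The group \<open>M\<^sub>X * M\<^sub>Y\<close>, that is \<open>(N\<^sub>X * N\<^sub>Y) S\<^bsub>X*Y\<^esub> / S\<^bsub>X*Y\<^esub>\<close>.  It consists of cosets of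
  \<open>S\<^bsub>X*Y\<^esub>\<close> and, for disjoint supports, is a subgroup of \<open>M\<^bsub>X*Y\<^esub>\<close> isomorphic to \<open>M\<^sub>X \<times> M\<^sub>Y\<close>.\<close>

definition M_star :: "(nat \<Rightarrow> nat) set \<Rightarrow> (nat \<Rightarrow> nat) set \<Rightarrow> (nat \<Rightarrow> nat) set monoid"
  where "M_star X Y =
    Symf\<lparr>carrier := (N_of X \<star> N_of Y) <#>\<^bsub>Symf\<^esub> S_of (X \<star> Y)\<rparr> Mod S_of (X \<star> Y)"

end

theory Submission
  imports Defs
begin

text \<open>Permutations with disjoint supports multiply independently: a product \<open>a \<circ> b\<close> of a permutation
  \<open>a\<close> supported in \<open>A\<close> and a permutation \<open>b\<close> supported in \<open>B\<close>, with \<open>A\<close> and \<open>B\<close> disjoint,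
  determines both factors (\<open>comp_disjoint_supp_cancel\<close>), and the two factors commute
  (\<open>comp_commute_disjoint_supp\<close>).  Hence a pair of such products commutes exactly when the
  factors over \<open>A\<close> commute and the factors over \<open>B\<close> commute
  (\<open>comp_disjoint_supp_commute_iff\<close>).

  An element that centralizes a set also normalizes it.  Coprimality says that the normalizer of
  \<open>X \<star> Y\<close> is \<open>N\<^sub>X \<star> N\<^sub>Y\<close>, so every element of the centralizer of \<open>X \<star> Y\<close> splits as a
  product of a permutation of \<open>supp X\<close> and one of \<open>supp Y\<close>.  Since \<open>X\<close> and
  \<open>Y\<close> are nonempty, such a product commutes with all \<open>x \<circ> y\<close> if and only if its factors
  centralize \<open>X\<close> and \<open>Y\<close>, which gives the equality of the centralizers.

  For the quotients, the centralizer is absorbed by the normalizer, so that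
  \<open>(N\<^sub>X \<star> N\<^sub>Y) \<star> S = N \<star> S = N\<close> with \<open>N\<close> and \<open>S\<close> the normalizer and the centralizer of
  \<open>X \<star> Y\<close>; both quotients are then \<open>N / S\<close>, literally the same group of cosets.\<close>

interpretation Symf: group Symf
  by (rule group_Symf)

lemma Symf_mult [simp]: "x \<otimes>\<^bsub>Symf\<^esub> y = x \<circ> y"
  by (simp add: Symf_def)

lemma Symf_bij: "x \<in> carrier Symf \<Longrightarrow> bij x"
  by (simp add: Symf_def)

lemma mem_star: "z \<in> X \<star> Y \<longleftrightarrow> (\<exists>x\<in>X. \<exists>y\<in>Y. z = x \<circ> y)"
  by (auto simp: set_mult_def)

lemma supp_perm_subset_supp: "x \<in> X \<Longrightarrow> supp_perm x \<subseteq> supp X"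
  by (auto simp: supp_def)

lemma comp_commute_disjoint_supp:
  assumes "inj a" and "inj b" and disj: "supp_perm a \<inter> supp_perm b = {}"
  shows "a \<circ> b = b \<circ> a"
proof
  \<comment> \<open>An injective map sends its support into itself.\<close>
  have invariant: "f n \<in> supp_perm f" if "inj f" "n \<in> supp_perm f" for f n
    using that by (auto simp: supp_perm_def dest: injD)
  fix n
  consider "n \<in> supp_perm a" | "n \<in> supp_perm b" | "n \<notin> supp_perm a" "n \<notin> supp_perm b"
    by blast
  then show "(a \<circ> b) n = (b \<circ> a) n"
  proof cases
    case 1
    then have "n \<notin> supp_perm b" "a n \<notin> supp_perm b"
      using disj invariant[OF \<open>inj a\<close>] by auto
    then show ?thesis by (simp add: supp_perm_def)
  next
    case 2
    then have "n \<notin> supp_perm a" "b n \<notin> supp_perm a"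
      using disj invariant[OF \<open>inj b\<close>] by auto
    then show ?thesis by (simp add: supp_perm_def)
  next
    case 3
    then show ?thesis by (simp add: supp_perm_def)
  qed
qed

text \<open>On \<open>A\<close> the right-hand factors \<open>b\<close> and \<open>d\<close> are trivial, so the product shows \<open>a\<close> and
  \<open>c\<close> there; off \<open>A\<close> these two are trivial anyway.\<close>

lemma comp_disjoint_supp_cancel:
  assumes "inj a" and eq: "a \<circ> b = c \<circ> d" and "A \<inter> B = {}"
    and "supp_perm a \<subseteq> A" and "supp_perm c \<subseteq> A"
    and "supp_perm b \<subseteq> B" and "supp_perm d \<subseteq> B"
  shows "a = c \<and> b = d"
proof -
  have ac: "a = c"
  proof
    fix n
    show "a n = c n"
    proof (cases "n \<in> A")
      case True
      then have "b n = n" "d n = n"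
        using assms unfolding supp_perm_def by blast+
      with fun_cong[OF eq, of n] show ?thesis by simp
    next
      case False
      then show ?thesis using assms unfolding supp_perm_def by force
    qed
  qed
  have "b n = d n" for n
    using fun_cong[OF eq, of n] \<open>inj a\<close> ac by (auto dest: injD)
  with ac show ?thesis by auto
qed

lemma supp_perm_comp_subset:
  "supp_perm a \<subseteq> A \<Longrightarrow> supp_perm b \<subseteq> A \<Longrightarrow> supp_perm (a \<circ> b) \<subseteq> A"
  unfolding supp_perm_def comp_def by force

lemma comp_disjoint_supp_commute_iff:
  assumes "inj a" "inj b" "inj x" "inj y" and disj: "A \<inter> B = {}"
    and supps: "supp_perm a \<subseteq> A" "supp_perm x \<subseteq> A" "supp_perm b \<subseteq> B" "supp_perm y \<subseteq> B"
  shows "(a \<circ> b) \<circ> (x \<circ> y) = (x \<circ> y) \<circ> (a \<circ> b) \<longleftrightarrow> a \<circ> x = x \<circ> a \<and> b \<circ> y = y \<circ> b"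
proof -
  have bx: "b \<circ> x = x \<circ> b" and ya: "y \<circ> a = a \<circ> y"
    using assms by (auto intro!: comp_commute_disjoint_supp)
  have l: "(a \<circ> b) \<circ> (x \<circ> y) = (a \<circ> x) \<circ> (b \<circ> y)"
    using bx by (metis comp_assoc)
  have r: "(x \<circ> y) \<circ> (a \<circ> b) = (x \<circ> a) \<circ> (y \<circ> b)"
    using ya by (metis comp_assoc)
  have "(a \<circ> x) \<circ> (b \<circ> y) = (x \<circ> a) \<circ> (y \<circ> b) \<Longrightarrow> a \<circ> x = x \<circ> a \<and> b \<circ> y = y \<circ> b"
    by (rule comp_disjoint_supp_cancel[where A=A and B=B])
      (use assms in \<open>simp_all add: inj_compose supp_perm_comp_subset\<close>)
  then show ?thesis unfolding l r by metis
qed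

text \<open>Both sets must be nonempty: an empty factor would make the whole product empty.\<close>

lemma supp_star:
  assumes "X \<noteq> {}" "Y \<noteq> {}" and disj: "supp X \<inter> supp Y = {}"
    and carr: "X \<subseteq> carrier Symf"
  shows "supp (X \<star> Y) = supp X \<union> supp Y"
proof -
  have "supp_perm (x \<circ> y) = supp_perm x \<union> supp_perm y" if "x \<in> X" "y \<in> Y" for x y
  proof -
    have d: "supp_perm x \<inter> supp_perm y = {}"
      using that disj supp_perm_subset_supp by blast
    have "inj x"
      using that carr Symf_bij bij_is_inj by blast
    show ?thesis
    proof (rule Set.set_eqI)
      fix n
      show "n \<in> supp_perm (x \<circ> y) \<longleftrightarrow> n \<in> supp_perm x \<union> supp_perm y"
      proof (cases "n \<in> supp_perm y")
        case True
        \<comment> \<open>Here \<open>x n = n\<close>, so \<open>x (y n) = n\<close> would force \<open>y n = n\<close>.\<close>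
        then have "x n = n" using d by (auto simp: supp_perm_def)
        then have "x (y n) \<noteq> n"
          using True \<open>inj x\<close> by (metis (mono_tags) injD mem_Collect_eq supp_perm_def)
        then show ?thesis using True by (auto simp: supp_perm_def)
      next
        case False
        then show ?thesis by (auto simp: supp_perm_def)
      qed
    qed
  qed
  moreover have "supp (X \<star> Y) = (\<Union>x\<in>X. \<Union>y\<in>Y. supp_perm (x \<circ> y))"
    by (simp add: supp_def set_mult_def)
  ultimately have "supp (X \<star> Y) = (\<Union>x\<in>X. \<Union>y\<in>Y. supp_perm x \<union> supp_perm y)"
    by simp
  then show ?thesis
    using assms(1,2) by (auto simp: supp_def)
qed

lemma G_of_mult_closed: "a \<in> G_of X \<Longrightarrow> b \<in> G_of X \<Longrightarrow> a \<circ> b \<in> G_of X"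
  using Symf.m_closed[of a b] by (simp add: G_of_def supp_perm_comp_subset)

lemma N_of_mult_closed:
  assumes X: "X \<subseteq> carrier Symf" and a: "a \<in> N_of X" and b: "b \<in> N_of X"
  shows "a \<circ> b \<in> N_of X"
proof -
  have ca: "a \<in> carrier Symf" and cb: "b \<in> carrier Symf"
    using a b by (auto simp: N_of_def G_of_def)
  have Xa: "X #>\<^bsub>Symf\<^esub> a \<subseteq> carrier Symf"
    using X ca by (rule Symf.r_coset_subset_G)
  have "inv\<^bsub>Symf\<^esub> (a \<otimes>\<^bsub>Symf\<^esub> b) <#\<^bsub>Symf\<^esub> (X #>\<^bsub>Symf\<^esub> (a \<otimes>\<^bsub>Symf\<^esub> b))
      = (inv\<^bsub>Symf\<^esub> b \<otimes>\<^bsub>Symf\<^esub> inv\<^bsub>Symf\<^esub> a) <#\<^bsub>Symf\<^esub> ((X #>\<^bsub>Symf\<^esub> a) #>\<^bsub>Symf\<^esub> b)"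
    using Symf.coset_mult_assoc[OF X ca cb] Symf.inv_mult_group[OF ca cb] by simp
  also have "\<dots> = inv\<^bsub>Symf\<^esub> b <#\<^bsub>Symf\<^esub> (inv\<^bsub>Symf\<^esub> a <#\<^bsub>Symf\<^esub> ((X #>\<^bsub>Symf\<^esub> a) #>\<^bsub>Symf\<^esub> b))"
    using Symf.lcos_m_assoc[OF Symf.r_coset_subset_G[OF Xa cb]
        Symf.inv_closed[OF cb] Symf.inv_closed[OF ca]] by simp
  also have "\<dots> = inv\<^bsub>Symf\<^esub> b <#\<^bsub>Symf\<^esub> ((inv\<^bsub>Symf\<^esub> a <#\<^bsub>Symf\<^esub> (X #>\<^bsub>Symf\<^esub> a)) #>\<^bsub>Symf\<^esub> b)"
    using Symf.coset_assoc[OF Symf.inv_closed[OF ca] cb Xa] by simp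
  also have "\<dots> = X"
    using a b by (simp add: N_of_def)
  finally show ?thesis
    using a b by (simp add: N_of_def G_of_mult_closed)
qed

lemma S_of_subset_N_of:
  assumes X: "X \<subseteq> carrier Symf"
  shows "S_of X \<subseteq> N_of X"
proof
  fix g assume g: "g \<in> S_of X"
  then have cg: "g \<in> carrier Symf" by (simp add: S_of_def G_of_def)
  have conj: "inv\<^bsub>Symf\<^esub> g \<otimes>\<^bsub>Symf\<^esub> (x \<otimes>\<^bsub>Symf\<^esub> g) = x" if "x \<in> X" for x
  proof -
    have "x \<otimes>\<^bsub>Symf\<^esub> g = g \<otimes>\<^bsub>Symf\<^esub> x" using g that unfolding S_of_def by simp
    then show ?thesis using Symf.inv_solve_left'[of x g "x \<otimes>\<^bsub>Symf\<^esub> g"] cg X that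
      by (metis Symf.m_closed subsetD)
  qed
  have "inv\<^bsub>Symf\<^esub> g <#\<^bsub>Symf\<^esub> (X #>\<^bsub>Symf\<^esub> g)
      = (\<lambda>x. inv\<^bsub>Symf\<^esub> g \<otimes>\<^bsub>Symf\<^esub> (x \<otimes>\<^bsub>Symf\<^esub> g)) ` X"
    by (auto simp: l_coset_def r_coset_def)
  also have "\<dots> = X" using conj by simp
  finally show "g \<in> N_of X" using g by (simp add: N_of_def S_of_def)
qed

lemma one_in_S_of: "id \<in> S_of X"
  using Symf.one_closed by (simp add: S_of_def G_of_def Symf_def supp_perm_def)

lemma N_of_absorbs_S_of:
  assumes X: "X \<subseteq> carrier Symf"
  shows "N_of X \<star> S_of X = N_of X"
proof
  show "N_of X \<star> S_of X \<subseteq> N_of X"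
    using N_of_mult_closed[OF X] S_of_subset_N_of[OF X] unfolding mem_star subset_iff by blast
  show "N_of X \<subseteq> N_of X \<star> S_of X"
    using one_in_S_of[of X] unfolding mem_star subset_iff by (metis comp_id)
qed

lemma S_of_star:
  assumes X: "X \<subseteq> carrier Symf" "X \<noteq> {}" and Y: "Y \<subseteq> carrier Symf" "Y \<noteq> {}"
    and disj: "supp X \<inter> supp Y = {}" and cop: "coprime_sets X Y"
  shows "S_of (X \<star> Y) = S_of X \<star> S_of Y"
proof -
  have inj: "inj g" if "g \<in> carrier Symf" for g
    using that Symf_bij bij_is_inj by blast
  have commute_iff: "(a \<circ> b) \<circ> (x \<circ> y) = (x \<circ> y) \<circ> (a \<circ> b) \<longleftrightarrow> a \<circ> x = x \<circ> a \<and> b \<circ> y = y \<circ> b"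
    if "a \<in> G_of X" "b \<in> G_of Y" "x \<in> X" "y \<in> Y" for a b x y
    by (rule comp_disjoint_supp_commute_iff[OF _ _ _ _ disj])
      (use that X Y in \<open>auto simp: G_of_def intro: inj dest: supp_perm_subset_supp\<close>)
  have XY: "X \<star> Y \<subseteq> carrier Symf"
    using X Y by (intro Symf.set_mult_closed)
  show ?thesis
  proof
    show "S_of (X \<star> Y) \<subseteq> S_of X \<star> S_of Y"
    proof
      fix g assume g: "g \<in> S_of (X \<star> Y)"
      then have "g \<in> N_of X \<star> N_of Y"
        using S_of_subset_N_of[OF XY] cop by (auto simp: coprime_sets_def)
      then obtain a b where ab: "a \<in> G_of X" "b \<in> G_of Y" "g = a \<circ> b"
        by (auto simp: mem_star N_of_def)
      have "g \<circ> (x \<circ> y) = (x \<circ> y) \<circ> g" if "x \<in> X" "y \<in> Y" for x y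
      proof -
        have "x \<circ> y \<in> X \<star> Y" using that by (auto simp: mem_star)
        then show ?thesis using g by (simp add: S_of_def)
      qed
      then have "a \<circ> x = x \<circ> a \<and> b \<circ> y = y \<circ> b" if "x \<in> X" "y \<in> Y" for x y
        using that commute_iff[OF ab(1,2) that] ab(3) by blast
      then have "a \<in> S_of X" "b \<in> S_of Y"
        using X Y ab by (auto simp: S_of_def)
      then show "g \<in> S_of X \<star> S_of Y"
        using ab by (auto simp: mem_star)
    qed
    show "S_of X \<star> S_of Y \<subseteq> S_of (X \<star> Y)"
    proof
      fix g assume "g \<in> S_of X \<star> S_of Y"
      then obtain a b where ab: "a \<in> S_of X" "b \<in> S_of Y" "g = a \<circ> b"
        by (auto simp: mem_star)
      then have G: "a \<in> G_of X" "b \<in> G_of Y" by (auto simp: S_of_def)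
      then have "a \<in> G_of (X \<star> Y)" "b \<in> G_of (X \<star> Y)"
        using supp_star[OF X(2) Y(2) disj X(1)] by (auto simp: G_of_def)
      then have "g \<in> G_of (X \<star> Y)"
        using ab(3) G_of_mult_closed by simp
      moreover have "g \<circ> (x \<circ> y) = (x \<circ> y) \<circ> g" if "x \<in> X" "y \<in> Y" for x y
        using commute_iff[OF G that] ab that by (simp add: S_of_def)
      ultimately show "g \<in> S_of (X \<star> Y)"
        unfolding S_of_def by (auto simp: mem_star)
    qed
  qed
qed

lemma M_of_star:
  assumes "X \<subseteq> carrier Symf" and "Y \<subseteq> carrier Symf" and "coprime_sets X Y"
  shows "M_of (X \<star> Y) = M_star X Y"
proof -
  have "N_of (X \<star> Y) \<star> S_of (X \<star> Y) = N_of (X \<star> Y)"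
    using assms(1,2) by (intro N_of_absorbs_S_of Symf.set_mult_closed)
  with assms(3) show ?thesis
    unfolding M_of_def M_star_def coprime_sets_def by simp
qed

theorem proposition5p4:
  fixes q :: nat and X Y :: "(nat \<Rightarrow> nat) set"
  assumes "q \<ge> 2"
    and "X \<in> Sq q" and "Y \<in> Sq q"
    and "supp X \<inter> supp Y = {}"
    and "coprime_sets X Y"
  shows "S_of (X \<star> Y) = S_of X \<star> S_of Y \<and> M_of (X \<star> Y) = M_star X Y"
proof -
  have "X \<subseteq> carrier Symf" "X \<noteq> {}" "Y \<subseteq> carrier Symf" "Y \<noteq> {}"
    using assms(2,3) by (auto simp: Sq_def)
  then show ?thesis
    using S_of_star M_of_star assms(4,5) by blast
qed

end
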